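(* Let $q\ge 2$ be a prime power and let $r=q+1$. Then the graph $R_q$ is a $(\{r,2r-3\};5)$-cage attaining Downs' lower bound, i.e. $n(\{r,2r-3\};5)=r(2r-3)+1$.
   Context: All graphs are finite, undirected and simple. The girth of a graph is the length of a shortest cycle. For a finite nonempty set $D$ of integers $\ge 2$, a $(D;g)$-graph is a graph of girth exactly $g$ whose set of vertex degrees is exactly $D$; $n(D;g)$ is the minimum order (number of vertices) of a $(D;g)$-graph, and a $(D;g)$-cage is a $(D;g)$-graph of order $n(D;g)$. (If $q=2$ then $r=2r-3=3$ and $\{r,2r-3\}=\{3\}$.) Downs' lower bound for girth $5$ and $D=\{r,m\}$, $r\le m$, is $n(\{r,m\};5)\ge 1+m+m(r-1)=rm+1$. Let $GF(q)$ be the field with $q$ elements and $GF^*(q)=GF(q)\setminus\{0\}$. The graph $B_q$ is the bipartite graph with vertex classes $V_0=\{(x,y)_0: x,y\in GF(q)\}$ and $V_1=\{(m,b)_1: m,b\in GF(q)\}$, in which $(x,y)_0$ is adjacent to $(m,b)_1$ if and only if $y=mx+b$. The graph $A_q$ is obtained from $B_q$ by adding $q$ new vertices $(q,x)_1$, $x\in GF(q)$ (here the first coordinate $q$ is a formal symbol not in $GF(q)$), and joining $(q,x)_1$ to $(x,y)_0$ for all $x,y\in GF(q)$. The graph $R_q$ has vertex set $V(R_q)=V(A_q)$ and edge set $E(R_q)=E(A_q)\cup\{(m,0)_1(m,b)_1 : b\in GF^*(q),\ m\in GF(q)\cup\{q\}\}$. *)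

theory Defs
  imports
    "HOL-Library.Extended_Nat"
    "HOL-Number_Theory.Prime_Powers"
    "HOL-Algebra.Ring"
    "Graph_Theory.Graph_Theory"
begin

text \<open>
  A finite simple undirected graph is a \<^locale>\<open>pair_graph\<close>: a finite, loopfree, symmetric
  pair digraph, in which an undirected edge \<open>uv\<close> is the pair of opposite arcs
  \<open>(u, v)\<close>, \<open>(v, u)\<close>. The degree of a vertex is therefore its out-degree. The undirected cycles
  are the library's cycles with at least three arcs; the two-arc cycles merely run
  back and forth along one edge.
\<close>

definition girth :: "'v pair_pre_digraph \<Rightarrow> enat" where
  "girth G = (INF p \<in> {p. pre_digraph.cycle (with_proj G) p \<and> 3 \<le> length p}. enat (length p))"

definition degree_set :: "'v pair_pre_digraph \<Rightarrow> nat set" where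
  "degree_set G = out_degree (with_proj G) ` pverts G"

definition is_Dg_graph :: "nat set \<Rightarrow> nat \<Rightarrow> 'v pair_pre_digraph \<Rightarrow> bool" where
  "is_Dg_graph D g G \<longleftrightarrow> pair_graph G \<and> degree_set G = D \<and> girth G = enat g"

text \<open>
  Every finite graph has an isomorphic copy on natural numbers, so the minimum may be taken over
  these. If there is no \<open>(D;g)\<close>-graph, the value is \<open>Inf {} = 0\<close>, which is not the order of
  any \<open>(D;g)\<close>-graph with \<open>D\<close> nonempty.
\<close>

definition min_order :: "nat set \<Rightarrow> nat \<Rightarrow> nat" where
  "min_order D g = Inf {card (pverts G) | G :: nat pair_pre_digraph. is_Dg_graph D g G}"

definition is_Dg_cage :: "nat set \<Rightarrow> nat \<Rightarrow> 'v pair_pre_digraph \<Rightarrow> bool" where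
  "is_Dg_cage D g G \<longleftrightarrow> is_Dg_graph D g G \<and> card (pverts G) = min_order D g"

text \<open>
  \<open>V0 x y\<close> is the vertex \<open>(x, y)\<^sub>0\<close> and \<open>V1 (Some m) b\<close> is \<open>(m, b)\<^sub>1\<close>. The formal symbol \<open>q\<close>,
  which is not a field element, is \<open>None\<close>, so that \<open>V1 None x\<close> is \<open>(q, x)\<^sub>1\<close>.
  Edges are listed in one direction and closed under reversal by \<^const>\<open>symcl\<close>.
\<close>

datatype 'a vertex = V0 'a 'a | V1 "'a option" 'a

definition B_graph :: "('a, 'b) ring_scheme \<Rightarrow> 'a vertex pair_pre_digraph" where
  "B_graph F = \<lparr>
     pverts = {V0 x y | x y. x \<in> carrier F \<and> y \<in> carrier F}
            \<union> {V1 (Some m) b | m b. m \<in> carrier F \<and> b \<in> carrier F},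
     parcs = symcl {(V0 x y, V1 (Some m) b) | x y m b.
               x \<in> carrier F \<and> y \<in> carrier F \<and> m \<in> carrier F \<and> b \<in> carrier F \<and>
               y = m \<otimes>\<^bsub>F\<^esub> x \<oplus>\<^bsub>F\<^esub> b} \<rparr>"

definition A_graph :: "('a, 'b) ring_scheme \<Rightarrow> 'a vertex pair_pre_digraph" where
  "A_graph F = \<lparr>
     pverts = pverts (B_graph F) \<union> {V1 None x | x. x \<in> carrier F},
     parcs = parcs (B_graph F)
           \<union> symcl {(V1 None x, V0 x y) | x y. x \<in> carrier F \<and> y \<in> carrier F} \<rparr>"

definition R_graph :: "('a, 'b) ring_scheme \<Rightarrow> 'a vertex pair_pre_digraph" where
  "R_graph F = \<lparr>
     pverts = pverts (A_graph F),
     parcs = parcs (A_graph F)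
           \<union> symcl {(V1 m \<zero>\<^bsub>F\<^esub>, V1 m b) | m b.
               b \<in> carrier F - {\<zero>\<^bsub>F\<^esub>} \<and> m \<in> Some ` carrier F \<union> {None}} \<rparr>"

end

theory Submission
  imports
    Defs
    "HOL-Number_Theory.Residues"
    "HOL-Algebra.Algebraic_Closure"
begin

text \<open>
  In \<open>A\<^sub>q\<close> two distinct points lie on at most one common line, so \<open>A\<^sub>q\<close> is bipartite without
  4-cycles. The new edges of \<open>R\<^sub>q\<close> form a star inside each parallel class of lines, and each point
  lies on exactly one line of each class; hence a new edge lies on no triangle and on no 4-cycle.
  Conversely, for a vertex \<open>v\<close> of degree \<open>2r - 3\<close> in a graph without triangles and 4-cycles, the
  vertices at distance at most two from \<open>v\<close> already number at least \<open>r(2r - 3) + 1\<close>.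

  The value of the minimum does not refer to a given field, and \<open>'a\<close> need not carry one of order
  \<open>q\<close>. So a field of order \<open>q = p ^ n\<close> is constructed, as the set of roots of \<open>X ^ q - X\<close> in an
  algebraic closure of the integers modulo \<open>p\<close>.
\<close>

(* Graph_Theory uses the same symbol as ring addition for joining vertex walks. *)
no_notation vwalk_join (infixr "\<oplus>" 65)

section \<open>Finite fields of prime power order\<close>

lemma (in cring) binomial_expansion:
  assumes x: "x \<in> carrier R" and y: "y \<in> carrier R"
  shows "(x \<oplus> y) [^] (n::nat) = (\<Oplus>k\<in>{..n}. [(n choose k)] \<cdot> (x [^] k \<otimes> y [^] (n - k)))"
proof (induction n)
  case 0
  show ?case using x y by simp
next
  case (Suc n)
  \<comment> \<open>Multiplying the inductive sum by \<open>y\<close> yields the \<open>t k\<close>,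
    by \<open>x\<close> the \<open>s k\<close>; Pascal's rule then merges \<open>s k\<close> with
    \<open>t (Suc k)\<close>.\<close>
  define t where "t k = [(n choose k)] \<cdot> (x [^] k \<otimes> y [^] (Suc n - k))" for k
  define s where "s k = [(n choose k)] \<cdot> (x [^] Suc k \<otimes> y [^] (n - k))" for k
  have tc: "t \<in> A \<rightarrow> carrier R" and sc: "s \<in> A \<rightarrow> carrier R" for A
    using x y by (auto simp: t_def s_def)
  have "x \<otimes> (\<Oplus>k\<in>{..n}. [(n choose k)] \<cdot> (x [^] k \<otimes> y [^] (n - k))) = (\<Oplus>k\<in>{..n}. s k)"
    using x y by (subst finsum_rdistr) (auto intro!: finsum_cong' simp: s_def add_pow_rdistr m_ac)
  moreover have "y \<otimes> (\<Oplus>k\<in>{..n}. [(n choose k)] \<cdot> (x [^] k \<otimes> y [^] (n - k))) = (\<Oplus>k\<in>{..n}. t k)"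
    using x y by (subst finsum_rdistr)
      (auto intro!: finsum_cong' simp: t_def add_pow_rdistr m_ac Suc_diff_le)
  \<comment> \<open>The added term has coefficient \<open>n choose Suc n\<close>, which is 0; the
    longer range allows the index shift that follows.\<close>
  moreover have "(\<Oplus>k\<in>{..n}. t k) = (\<Oplus>k\<in>{..Suc n}. t k)"
    using finsum_Suc[of t n] tc x y
    by (simp add: t_def binomial_eq_0)
  moreover have "\<dots> = (\<Oplus>k\<in>{..n}. t (Suc k)) \<oplus> t 0"
    using tc by (rule finsum_Suc2)
  ultimately have "(x \<oplus> y) [^] Suc n = (\<Oplus>k\<in>{..n}. s k) \<oplus> ((\<Oplus>k\<in>{..n}. t (Suc k)) \<oplus> t 0)"
    using x y Suc by (simp add: m_comm[of _ "x \<oplus> y"] l_distr)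
  also have "\<dots> = (\<Oplus>k\<in>{..n}. s k \<oplus> t (Suc k)) \<oplus> t 0"
  proof -
    have "(\<lambda>k. t (Suc k)) \<in> {..n} \<rightarrow> carrier R" "t 0 \<in> carrier R"
      using tc by auto
    with sc show ?thesis by (simp add: finsum_addf a_assoc)
  qed
  also have "\<dots> = (\<Oplus>k\<in>{..Suc n}. [(Suc n choose k)] \<cdot> (x [^] k \<otimes> y [^] (Suc n - k)))"
    using x y by (subst finsum_Suc2)
      (auto intro!: finsum_cong' arg_cong2[where f="(\<oplus>)"] simp: s_def t_def add.nat_pow_mult simp del: nat_pow_Suc)
  finally show ?case .
qed

text \<open>For \<open>0 < k < p\<close> the prime \<open>p\<close> divides
  \<open>p choose k\<close>, so only the two outer terms survive.\<close>

lemma (in cring) freshmans_dream: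
  assumes p: "Factorial_Ring.prime (p::nat)" and char: "[p] \<cdot> \<one> = \<zero>"
    and x: "x \<in> carrier R" and y: "y \<in> carrier R"
  shows "(x \<oplus> y) [^] p = x [^] p \<oplus> y [^] p"
proof -
  define f where "f k = [(p choose k)] \<cdot> (x [^] k \<otimes> y [^] (p - k))" for k
  have fc: "f \<in> A \<rightarrow> carrier R" for A using x y by (auto simp: f_def)
  have p2: "p \<ge> 2" using p prime_ge_2_nat by blast
  have pz: "[p] \<cdot> z = \<zero>" if "z \<in> carrier R" for z
    using add_pow_ldistr[of \<one> z p] char that by simp
  have z: "f k = \<zero>" if k: "0 < k" "k < p" for k
  proof -
    have "p dvd (p choose k)"
      using p k by (intro dvd_choose_prime) auto
    then obtain m where "p choose k = p * m" by blast
    then show ?thesis using x y pz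
      by (simp add: f_def add.nat_pow_pow[symmetric] mult.commute[of p m])
  qed
  \<comment> \<open>Here \<open>m = p - 2\<close>: once \<open>k = p\<close> and
    \<open>k = 0\<close> are split off, the inner indices are \<open>Suc k\<close> with
    \<open>k \<le> m\<close>.\<close>
  obtain m where m: "p = Suc (Suc m)" using p2 by (metis add_2_eq_Suc le_Suc_ex)
  have "(x \<oplus> y) [^] p = (\<Oplus>k\<in>{..p}. f k)"
    using binomial_expansion[OF x y] by (simp add: f_def)
  also have "\<dots> = f p \<oplus> ((\<Oplus>k\<in>{..m}. f (Suc k)) \<oplus> f 0)"
    using fc finsum_Suc[of f "Suc m"] finsum_Suc2[of f m] by (simp add: m)
  also have "(\<Oplus>k\<in>{..m}. f (Suc k)) = \<zero>"
    using z m by (intro add.finprod_one_eqI) auto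
  finally show ?thesis using x y by (simp add: f_def)
qed

lemma (in cring) freshmans_dream_power:
  assumes p: "Factorial_Ring.prime (p::nat)" and char: "[p] \<cdot> \<one> = \<zero>"
    and x: "x \<in> carrier R" and y: "y \<in> carrier R"
  shows "(x \<oplus> y) [^] (p ^ n) = x [^] (p ^ n) \<oplus> y [^] (p ^ n)"
proof (induction n)
  case (Suc n)
  then show ?case using x y freshmans_dream[OF p char]
    by (simp add: nat_pow_pow[symmetric] mult.commute[of p])
qed (use x y in simp)

section \<open>Roots of X^q - X and the field they form\<close>

lemma (in domain) poly_ring_var_pow_minus_var:
  fixes q :: nat
  assumes q: "2 \<le> q"
  defines "f \<equiv> X [^]\<^bsub>poly_ring R\<^esub> q \<ominus>\<^bsub>poly_ring R\<^esub> X"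
  shows "f \<in> carrier (poly_ring R)" "degree f = q"
    "x \<in> carrier R \<Longrightarrow> eval f x = x [^] q \<ominus> x"
proof -
  interpret UP: domain "poly_ring R"
    using univ_poly_is_domain[OF carrier_is_subring] .
  have X: "X \<in> carrier (poly_ring R)"
    using var_closed(1)[OF carrier_is_subring] .
  show fc: "f \<in> carrier (poly_ring R)" unfolding f_def using X by simp
  have Xq: "X [^]\<^bsub>poly_ring R\<^esub> q = monom \<one> q"
    using unitary_monom_eq_var_pow[OF carrier_is_subring] by simp
  have dn: "degree (\<ominus>\<^bsub>poly_ring R\<^esub> X) = 1"
    using univ_poly_a_inv_degree[OF carrier_is_subring X] by (simp add: var_def)
  \<comment> \<open>As \<open>q \<ge> 2\<close>, the two summands have different degrees, so the
    leading term survives.\<close>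
  have "degree (poly_add (monom \<one> q) (\<ominus>\<^bsub>poly_ring R\<^esub> X)) = max q 1"
    using X poly_add_degree_eq[OF carrier_is_subring, of "monom \<one> q" "\<ominus>\<^bsub>poly_ring R\<^esub> X"]
      dn q UP.nat_pow_closed[OF X, of q] UP.a_inv_closed[OF X]
    by (simp add: Xq[symmetric] univ_poly_carrier del: poly_add.simps)
      (simp add: Xq monom_def del: poly_add.simps)
  then show "degree f = q"
    using q by (simp add: f_def Xq a_minus_def univ_poly_add)
  assume x: "x \<in> carrier R"
  interpret E: ring_hom_cring "poly_ring R" R "\<lambda>p. eval p x"
    using eval_cring_hom[OF carrier_is_subring x] .
  have "eval X x = x" using eval_var[OF x] .
  then show "eval f x = x [^] q \<ominus> x"
    unfolding f_def a_minus_def using X by simp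
qed

lemma (in ring_hom_ring) hom_add_pow:
  "x \<in> carrier R \<Longrightarrow> h ([(n::nat)] \<cdot>\<^bsub>R\<^esub> x) = [n] \<cdot>\<^bsub>S\<^esub> h x"
  by (induction n) auto

text \<open>
  If \<open>a ^ q = a\<close>, then \<open>X ^ q - X = (X - a) ^ q - (X - a)\<close>, in which the cofactor
  \<open>(X - a) ^ (q - 1) - 1\<close> of \<open>X - a\<close> does not vanish at \<open>a\<close>; this avoids formal derivatives.
\<close>
lemma (in domain) alg_mult_var_pow_minus_var:
  fixes p n :: nat
  assumes p: "Factorial_Ring.prime p" and char: "[p] \<cdot> \<one> = \<zero>" and n: "n > 0"
  shows "alg_mult (X [^]\<^bsub>poly_ring R\<^esub> (p ^ n) \<ominus>\<^bsub>poly_ring R\<^esub> X) a \<le> 1"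
proof (rule ccontr)
  define q where "q = p ^ n"
  have q: "2 \<le> q"
    using prime_ge_2_nat[OF p] n self_le_power[of p n] by (simp add: q_def)
  let ?P = "poly_ring R"
  interpret UP: domain ?P
    using univ_poly_is_domain[OF carrier_is_subring] .
  interpret C: ring_hom_ring R ?P poly_of_const
    using canonical_embedding_ring_hom[OF carrier_is_subring] by simp
  define f where "f = X [^]\<^bsub>?P\<^esub> q \<ominus>\<^bsub>?P\<^esub> X"
  note f = poly_ring_var_pow_minus_var[OF q, folded f_def]
  assume "\<not> alg_mult (X [^]\<^bsub>?P\<^esub> (p ^ n) \<ominus>\<^bsub>?P\<^esub> X) a \<le> 1"
  then have two: "2 \<le> alg_mult f a" by (simp add: f_def q_def)
  then have "is_root f a"
    using alg_mult_gt_zero_iff_is_root[OF f(1), of a] by simp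
  then have a: "a \<in> carrier R" and "eval f a = \<zero>"
    by (auto simp: is_root_def)
  then have aq: "a [^] q = a" using f(3)[OF a] by (simp add: r_right_minus_eq)
  \<comment> \<open>\<open>Y\<close> is X - a as a coefficient list; the constant polynomial
    \<open>c\<close> below is fixed by the q-th power because \<open>a\<close> is a root.\<close>
  define Y where "Y = [\<one>, \<ominus> a]"
  have X: "X \<in> carrier ?P"
    using var_closed(1)[OF carrier_is_subring] .
  have Yc: "Y \<in> carrier ?P"
    using a unfolding Y_def sym[OF univ_poly_carrier] polynomial_def by auto
  define c where "c = poly_of_const a"
  have c: "c \<in> carrier ?P" unfolding c_def using a by simp
  have cq: "c [^]\<^bsub>?P\<^esub> q = c"
    unfolding c_def using C.hom_nat_pow[OF a, of q] aq by simp
  have XY: "X = Y \<oplus>\<^bsub>?P\<^esub> c"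
    using a by (simp add: Y_def c_def poly_of_const_def var_def univ_poly_add l_neg)
  have "[p] \<cdot>\<^bsub>?P\<^esub> \<one>\<^bsub>?P\<^esub> = \<zero>\<^bsub>?P\<^esub>"
    using C.hom_add_pow[of \<one> p] char by simp
  then have "X [^]\<^bsub>?P\<^esub> q = Y [^]\<^bsub>?P\<^esub> q \<oplus>\<^bsub>?P\<^esub> c"
    using UP.freshmans_dream_power[OF p _ Yc c, of n] cq by (simp add: XY q_def)
  then have fY: "f = Y [^]\<^bsub>?P\<^esub> q \<ominus>\<^bsub>?P\<^esub> Y"
    unfolding f_def using XY Yc c X
    by (simp add: UP.minus_eq UP.minus_add UP.a_ac UP.r_neg2 UP.r_neg1)
  have "Y [^]\<^bsub>?P\<^esub> (2::nat) pdivides f"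
    using le_alg_mult_imp_pdivides[OF a f(1) two] by (simp add: Y_def)
  then obtain g where g: "g \<in> carrier ?P" "f = Y [^]\<^bsub>?P\<^esub> (2::nat) \<otimes>\<^bsub>?P\<^esub> g"
    unfolding pdivides_def by auto
  obtain m where m: "q = Suc m" "m > 0" using q by (cases q) auto
  \<comment> \<open>Both forms of \<open>f\<close>, namely Y^2 g and Y^q - Y, are written with a
    factor \<open>Y\<close> in front, which is cancelled next.\<close>
  have "Y \<otimes>\<^bsub>?P\<^esub> (Y \<otimes>\<^bsub>?P\<^esub> g) = Y \<otimes>\<^bsub>?P\<^esub> (Y [^]\<^bsub>?P\<^esub> m \<ominus>\<^bsub>?P\<^esub> \<one>\<^bsub>?P\<^esub>)"
    using fY g Yc by (simp add: m numeral_2_eq_2 UP.m_ac UP.minus_eq UP.r_distr UP.r_minus)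
  then have eq: "Y \<otimes>\<^bsub>?P\<^esub> g = Y [^]\<^bsub>?P\<^esub> m \<ominus>\<^bsub>?P\<^esub> \<one>\<^bsub>?P\<^esub>"
    using UP.m_lcancel[of Y] Yc g by (simp add: Y_def univ_poly_zero)
  interpret E: ring_hom_cring ?P R "\<lambda>p. eval p a"
    using eval_cring_hom[OF carrier_is_subring a] .
  have Ya: "eval Y a = \<zero>" using a by (simp add: Y_def r_neg)
  \<comment> \<open>At \<open>a\<close> the left side vanishes, while the right side is -1 because
    \<open>m > 0\<close>.\<close>
  have "eval (Y \<otimes>\<^bsub>?P\<^esub> g) a = \<zero>" using Yc g Ya by simp
  moreover have "eval (Y [^]\<^bsub>?P\<^esub> m \<ominus>\<^bsub>?P\<^esub> \<one>\<^bsub>?P\<^esub>) a = \<ominus> \<one>"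
    using Yc Ya m by (simp add: UP.minus_eq nat_pow_zero)
  ultimately have "\<ominus> \<one> = \<zero>" using eq by simp
  then show False by simp
qed

text \<open>\<open>K\<close> is the fixed set of a power map that is additive and multiplicative,
  hence a subfield. Its elements are the roots of X^(p^n) - X, which splits here and has only simple
  roots, so its degree counts them.\<close>

lemma (in algebraically_closed) subfield_of_order:
  fixes p n :: nat
  assumes p: "Factorial_Ring.prime p" and char: "[p] \<cdot> \<one> = \<zero>" and n: "n > 0"
  defines "K \<equiv> {x \<in> carrier L. x [^] (p ^ n) = x}"
  shows "subfield K L" and "card K = p ^ n"
proof -
  have q: "2 \<le> p ^ n"
    using prime_ge_2_nat[OF p] n self_le_power[of p n] by simp
  have zero_pow: "\<zero> [^] (p ^ n) = \<zero>"
    using q by (intro nat_pow_zero) linarith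
  note add_pow = freshmans_dream_power[OF p char, of _ _ n]
  define f where "f = X [^]\<^bsub>poly_ring L\<^esub> (p ^ n) \<ominus>\<^bsub>poly_ring L\<^esub> X"
  note f = poly_ring_var_pow_minus_var[OF q, folded f_def]
  have "f \<noteq> []" using f(2) q by (cases f) (simp_all del: power_eq_0_iff)
  then have root: "is_root f x \<longleftrightarrow> x \<in> K" for x
    by (cases "x \<in> carrier L") (simp_all add: is_root_def K_def f(3))
  \<comment> \<open>Multiplicities at most 1 turn the multiset of roots into a set, so its size is
    the cardinality of \<open>K\<close>.\<close>
  have "roots f = mset_set (set_mset (roots f))"
  proof (rule multiset_eqI)
    fix x
    have "count (roots f) x \<le> 1"
      using alg_mult_var_pow_minus_var[OF p char n, of x] alg_mult_eq_count_roots[OF f(1)]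
      by (simp add: f_def)
    then show "count (roots f) x = count (mset_set (set_mset (roots f))) x"
      by (cases "x \<in># roots f") (auto simp: count_mset_set' count_eq_zero_iff le_Suc_eq)
  qed
  moreover have "set_mset (roots f) = K"
    using roots_mem_iff_is_root[OF f(1)] root by auto
  ultimately have "size (roots f) = card K"
    by (metis size_mset_set)
  then show "card K = p ^ n"
    using roots_over_carrier[OF f(1)] f(2) by (simp add: splitted_def)
  have neg: "\<ominus> x \<in> K" if x: "x \<in> K" for x
  proof -
    \<comment> \<open>Additivity of the power map handles p = 2 and odd p alike, without a sign rule
      for powers of -x.\<close>
    have "(\<ominus> x) [^] (p ^ n) \<oplus> x = (\<ominus> x \<oplus> x) [^] (p ^ n)"
      using x add_pow[of "\<ominus> x" x] by (simp add: K_def)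
    also have "\<dots> = \<zero>" using x zero_pow by (simp add: K_def l_neg)
    finally show ?thesis using x minus_equality[of "(\<ominus> x) [^] (p ^ n)" x] by (simp add: K_def)
  qed
  have "subring K L"
    using zero_pow neg add_pow by (intro subringI) (auto simp: K_def nat_pow_distrib)
  moreover have "inv x \<in> K" if x: "x \<in> K - {\<zero>}" for x
  proof -
    have u: "x \<in> Units L" using x by (simp add: K_def field_Units)
    have "inv x [^] (p ^ n) \<otimes> x = (inv x \<otimes> x) [^] (p ^ n)"
      using x u nat_pow_distrib[of "inv x" x "p ^ n"] by (simp add: K_def del: Units_l_inv)
    also have "\<dots> = \<one>" using u by simp
    finally have "inv x [^] (p ^ n) = inv x"
      using x u comm_inv_char[of x "inv x [^] (p ^ n)"] by (simp add: K_def m_comm)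
    then show ?thesis using u by (simp add: K_def)
  qed
  ultimately show "subfield K L" by (rule subfieldI')
qed

lemma finite_field_exists:
  assumes "primepow q"
  shows "\<exists>F :: ((int list \<times> nat) multiset \<Rightarrow> int) ring. field F \<and> card (carrier F) = q"
proof -
  obtain p n where p: "Factorial_Ring.prime p" and n: "n > 0" and q: "q = p ^ n"
    using assms by (auto simp: primepow_def)
  define R where "R = residue_ring (int p)"
  interpret R: residues_prime p R
    using p by unfold_locales (simp_all add: R_def)
  interpret A: algebraic_closure R.alg_closure "R.indexed_const ` carrier R"
    using R.alg_closureE(1) .
  interpret h: ring_hom_ring R R.alg_closure R.indexed_const
    using R.alg_closureE(2) by (intro ring_hom_ringI2 R.ring_axioms A.ring_axioms)
  \<comment> \<open>The characteristic is computed among the residues and carried to the closure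
    along the embedding.\<close>
  have "[m] \<cdot>\<^bsub>R\<^esub> \<one>\<^bsub>R\<^esub> = int m mod int p" for m :: nat
    by (induction m) (simp_all add: R.res_add_eq R.res_one_eq R.res_zero_eq mod_simps ac_simps)
  then have "[p] \<cdot>\<^bsub>R.alg_closure\<^esub> \<one>\<^bsub>R.alg_closure\<^esub> = \<zero>\<^bsub>R.alg_closure\<^esub>"
    using h.hom_add_pow[of "\<one>\<^bsub>R\<^esub>" p] by (simp add: R.res_zero_eq[symmetric])
  note K = A.subfield_of_order[OF p this n]
  show ?thesis
    using A.subfield_iff(2)[OF K(1)] K(2) q by (intro exI conjI) auto
qed

section \<open>Graphs of girth 5\<close>

lemma cycle_with_proj_iff:
  "pre_digraph.cycle (with_proj G) p \<longleftrightarrow>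
    (\<exists>u. u \<in> pverts G \<and> set p \<subseteq> parcs G \<and> pcas u p u \<and> distinct (tl (pawalk_verts u p)) \<and> p \<noteq> [])"
  by (simp add: pre_digraph.cycle_def pre_digraph.awalk_def cas_with_proj_eq awalk_verts_with_proj_eq)

text \<open>Girth 5 without walks or infima, so that it can be checked by cases on vertices. In
  \<open>no_triangle\<close> the case \<open>a = b = c\<close> excludes loops as well.\<close>

locale girth_5_relation =
  fixes E :: "'v rel"
  assumes no_triangle: "\<lbrakk>(a, b) \<in> E; (b, c) \<in> E; (c, a) \<in> E\<rbrakk> \<Longrightarrow> False"
    and no_4_cycle: "\<lbrakk>(a, b) \<in> E; (b, c) \<in> E; (c, d) \<in> E; (d, a) \<in> E; a \<noteq> c\<rbrakk> \<Longrightarrow> b = d"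
    and ex_5_cycle: "\<exists>a b c d e. distinct [a, b, c, d, e] \<and>
      {(a, b), (b, c), (c, d), (d, e), (e, a)} \<subseteq> E"

lemma girth_5_relationI:
  assumes "\<And>a b c. \<lbrakk>(a, b) \<in> E; (b, c) \<in> E; (c, a) \<in> E\<rbrakk> \<Longrightarrow> False"
    and "\<And>a b c d. \<lbrakk>(a, b) \<in> E; (b, c) \<in> E; (c, d) \<in> E; (d, a) \<in> E; a \<noteq> c\<rbrakk> \<Longrightarrow> b = d"
    and "distinct [a, b, c, d, e]" "{(a, b), (b, c), (c, d), (d, e), (e, a)} \<subseteq> E"
  shows "girth_5_relation E"
proof (rule girth_5_relation.intro)
  show "\<exists>a b c d e. distinct [a, b, c, d, e] \<and> {(a, b), (b, c), (c, d), (d, e), (e, a)} \<subseteq> E"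
    using assms(3,4) by (intro exI conjI)
qed (fact assms(1,2))+

lemma (in girth_5_relation) five_cycle:
  obtains a b c d e where "distinct [a, b, c, d, e]"
    "{(a, b), (b, c), (c, d), (d, e), (e, a)} \<subseteq> E"
proof -
  from ex_5_cycle obtain a b c d e where "distinct [a, b, c, d, e] \<and>
      {(a, b), (b, c), (c, d), (d, e), (e, a)} \<subseteq> E"
    by (elim exE)
  then show thesis by (elim conjE) (rule that)
qed

lemma (in pair_graph) girth_eq_5_iff: "girth G = enat 5 \<longleftrightarrow> girth_5_relation (parcs G)"
proof
  let ?C = "{p. pre_digraph.cycle (with_proj G) p \<and> 3 \<le> length p}"
  assume g: "girth G = enat 5"
  have le: "5 \<le> length p" if "p \<in> ?C" for p
    using INF_lower[OF that, of "\<lambda>p. enat (length p)"] g by (simp add: girth_def)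
  have "?C \<noteq> {}"
  \<comment> \<open>An infimum over no cycles at all would be infinite.\<close>
  proof
    assume "?C = {}"
    then have "girth G = \<infinity>"
      unfolding girth_def by (simp only: image_empty Inf_empty top_enat_def)
    with g show False by simp
  qed
  \<comment> \<open>\<open>enat\<close> is well-ordered, so the infimum is attained by an actual
    cycle.\<close>
  then have "\<exists>p \<in> ?C. length p = 5"
    using g wellorder_InfI[of _ "(\<lambda>p. enat (length p)) ` ?C"] unfolding girth_def by fastforce
  then obtain p where p: "pre_digraph.cycle (with_proj G) p" "length p = 5" by blast
  then obtain a b c d e where abc: "p = [a, b, c, d, e]"
    by (auto simp: numeral_eq_Suc length_Suc_conv)
  obtain u where u: "set p \<subseteq> parcs G" "pcas u p u" "distinct (tl (pawalk_verts u p))"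
    using p(1) unfolding cycle_with_proj_iff by blast
  have three: "(c, a) \<notin> parcs G" if "(a, b) \<in> parcs G" "(b, c) \<in> parcs G" for a b c
  proof
    assume "(c, a) \<in> parcs G"
    then have "[(a, b), (b, c), (c, a)] \<in> ?C"
      using that no_loops' in_arcsD1 unfolding cycle_with_proj_iff by auto
    from le[OF this] show False by simp
  qed
  \<comment> \<open>Consecutive vertices differ because there are no loops; only the two diagonal
    pairs need assumptions.\<close>
  have four: "(d, a) \<notin> parcs G"
    if "(a, b) \<in> parcs G" "(b, c) \<in> parcs G" "(c, d) \<in> parcs G" "a \<noteq> c" "b \<noteq> d" for a b c d
  proof
    assume "(d, a) \<in> parcs G"
    then have "[(a, b), (b, c), (c, d), (d, a)] \<in> ?C"
      using that no_loops' in_arcsD1 unfolding cycle_with_proj_iff by auto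
    from le[OF this] show False by simp
  qed
  show "girth_5_relation (parcs G)"
  proof (rule girth_5_relationI)
    \<comment> \<open>As the walk is closed, the tails of its five arcs are exactly the vertices of
      the cycle.\<close>
    show "distinct [fst a, fst b, fst c, fst d, fst e]"
      using u abc by auto
    show "{(fst a, fst b), (fst b, fst c), (fst c, fst d), (fst d, fst e), (fst e, fst a)} \<subseteq> parcs G"
      using u abc by (cases a; cases b; cases c; cases d; cases e) simp
    show False if "(a, b) \<in> parcs G" "(b, c) \<in> parcs G" "(c, a) \<in> parcs G" for a b c
      using three that by blast
    show "b = d" if "(a, b) \<in> parcs G" "(b, c) \<in> parcs G" "(c, d) \<in> parcs G" "(d, a) \<in> parcs G"
        "a \<noteq> c" for a b c d
      using four[OF that(1-3,5)] that(4) by blast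
  qed
next
  let ?C = "{p. pre_digraph.cycle (with_proj G) p \<and> 3 \<le> length p}"
  assume E: "girth_5_relation (parcs G)"
  then obtain a b c d e where "distinct [a, b, c, d, e]"
    "{(a, b), (b, c), (c, d), (d, e), (e, a)} \<subseteq> parcs G"
    by (rule girth_5_relation.five_cycle)
  then have "[(a, b), (b, c), (c, d), (d, e), (e, a)] \<in> ?C"
    using in_arcsD1 unfolding cycle_with_proj_iff by auto
  from INF_lower[OF this, of "\<lambda>p. enat (length p)"] have "girth G \<le> enat 5"
    by (simp add: girth_def numeral_eq_Suc)
  moreover have "5 \<le> length p" if "p \<in> ?C" for p
  proof (rule ccontr)
    assume "\<not> 5 \<le> length p"
    moreover from that have "3 \<le> length p" by simp
    ultimately consider "length p = 3" | "length p = 4" by linarith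
    then show False
    proof cases
      case 1
      then obtain e f g where "p = [e, f, g]" by (auto simp: numeral_eq_Suc length_Suc_conv)
      then obtain a a' b b' c c' where "p = [(a, a'), (b, b'), (c, c')]"
        by (cases e; cases f; cases g) simp
      with that have "(a, b) \<in> parcs G" "(b, c) \<in> parcs G" "(c, a) \<in> parcs G"
        by (auto simp: cycle_with_proj_iff)
      then show False by (rule girth_5_relation.no_triangle[OF E])
    next
      case 2
      then obtain e f g h where "p = [e, f, g, h]" by (auto simp: numeral_eq_Suc length_Suc_conv)
      then obtain a a' b b' c c' d d' where "p = [(a, a'), (b, b'), (c, c'), (d, d')]"
        by (cases e; cases f; cases g; cases h) simp
      with that have "(a, b) \<in> parcs G" "(b, c) \<in> parcs G" "(c, d) \<in> parcs G" "(d, a) \<in> parcs G"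
        "a \<noteq> c" "b \<noteq> d"
        by (auto simp: cycle_with_proj_iff)
      then show False using girth_5_relation.no_4_cycle[OF E] by metis
    qed
  qed
  then have "enat 5 \<le> girth G"
    unfolding girth_def by (intro INF_greatest) simp
  ultimately show "girth G = enat 5" by (rule antisym)
qed

section \<open>Degrees and Downs' lower bound\<close>

lemma out_degree_with_proj: "out_degree (with_proj G) v = card {w. (v, w) \<in> parcs G}"
proof -
  have "out_arcs (with_proj G) v = Pair v ` {w. (v, w) \<in> parcs G}"
    by (auto simp: out_arcs_def)
  then show ?thesis
    by (simp add: out_degree_def card_image inj_on_def)
qed

lemma pair_graphI:
  assumes "finite (pverts G)" "parcs G \<subseteq> pverts G \<times> pverts G" "sym (parcs G)" "\<And>v. (v, v) \<notin> parcs G"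
  shows "pair_graph G"
proof unfold_locales
  show "finite (parcs G)" using assms(1,2) finite_subset by blast
qed (use assms in \<open>auto simp: symmetric_def\<close>)

text \<open>With d the degree of \<open>v\<close>, the count is 1 for \<open>v\<close>, d for its
  neighbours, and at least r - 1 further neighbours for each of those, in all 1 + d + d(r - 1) = dr
  + 1.\<close>

lemma (in pair_graph) Downs_lower_bound:
  assumes E: "girth_5_relation (parcs G)" and v: "v \<in> pverts G"
    and r: "\<And>w. w \<in> pverts G \<Longrightarrow> r \<le> out_degree (with_proj G) w"
  shows "out_degree (with_proj G) v * r + 1 \<le> card (pverts G)"
proof -
  define N where "N w = {u. (w, u) \<in> parcs G}" for w
  have fin: "finite (N w)" for w
    using in_arcsD2 by (intro finite_subset[OF _ pair_finite_verts]) (auto simp: N_def)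
  have sym: "(b, a) \<in> parcs G" if "(a, b) \<in> parcs G" for a b
    using arcs_symmetric[OF that] .
  have "r - 1 \<le> card (N w - {v})" if "w \<in> N v" for w
    using that r[of w] in_arcsD2[of v w] sym[of v w] fin
    by (simp add: out_degree_with_proj N_def)
  then have "card (N v) * (r - 1) \<le> (\<Sum>w\<in>N v. card (N w - {v}))"
    using sum_mono[of "N v" "\<lambda>_. r - 1"] by simp
  also have "\<dots> = card (\<Union>w\<in>N v. N w - {v})"
  \<comment> \<open>A vertex other than \<open>v\<close> adjacent to both \<open>w\<close> and
    \<open>w'\<close> would close a 4-cycle through \<open>v\<close>.\<close>
  proof (rule card_UN_disjoint[symmetric])
    show "\<forall>w\<in>N v. \<forall>w'\<in>N v. w \<noteq> w' \<longrightarrow> (N w - {v}) \<inter> (N w' - {v}) = {}"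
      using girth_5_relation.no_4_cycle[OF E, of v] sym by (auto simp: N_def)
  qed (use fin in auto)
  finally have 1: "card (N v) * (r - 1) \<le> card (\<Union>w\<in>N v. N w - {v})" .
  have "card (insert v (N v \<union> (\<Union>w\<in>N v. N w - {v}))) = Suc (card (N v) + card (\<Union>w\<in>N v. N w - {v}))"
  proof -
    have "v \<notin> N v" using no_loops' by (auto simp: N_def)
    moreover have "N v \<inter> (\<Union>w\<in>N v. N w - {v}) = {}"
      using girth_5_relation.no_triangle[OF E, of v] sym unfolding N_def by blast
    ultimately show ?thesis
      using fin by (subst card_insert_disjoint) (auto simp: card_Un_disjoint)
  qed
  moreover have "insert v (N v \<union> (\<Union>w\<in>N v. N w - {v})) \<subseteq> pverts G"
    using v in_arcsD2 by (auto simp: N_def)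
  ultimately have "Suc (card (N v) + card (\<Union>w\<in>N v. N w - {v})) \<le> card (pverts G)"
    using card_mono[OF pair_finite_verts] by metis
  \<comment> \<open>Only an inequality is claimed, since \<open>r - 1\<close> is truncated at
    \<open>r = 0\<close>.\<close>
  moreover have "card (N v) * r \<le> card (N v) + card (N v) * (r - 1)"
    by (cases r) auto
  ultimately show ?thesis
    using 1 by (simp add: out_degree_with_proj N_def)
qed

section \<open>Copies of graphs on the natural numbers\<close>

definition map_graph :: "('v \<Rightarrow> 'w) \<Rightarrow> 'v pair_pre_digraph \<Rightarrow> 'w pair_pre_digraph" where
  "map_graph f G = \<lparr>pverts = f ` pverts G, parcs = map_prod f f ` parcs G\<rparr>"

text \<open>\<open>min_order\<close> compares graphs on \<open>nat\<close> only, so a graph on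
  another type enters through a relabelling. As \<open>f\<close> is injective merely on the
  vertices, arcs of the image are first pulled back to arcs between vertices of
  \<open>G\<close>.\<close>

lemma is_Dg_graph_map_graph:
  assumes G: "is_Dg_graph D 5 G" and inj: "inj_on f (pverts G)"
  shows "is_Dg_graph D 5 (map_graph f G)"
proof -
  interpret G: pair_graph G using G by (simp add: is_Dg_graph_def)
  note verts = G.in_arcsD1 G.in_arcsD2
  have arcE: "\<exists>u v. a = f u \<and> b = f v \<and> u \<in> pverts G \<and> v \<in> pverts G \<and> (u, v) \<in> parcs G"
    if "(a, b) \<in> parcs (map_graph f G)" for a b
    using that verts unfolding map_graph_def map_prod_def by fastforce
  have arc_iff: "(f u, f v) \<in> parcs (map_graph f G) \<longleftrightarrow> (u, v) \<in> parcs G"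
    if "u \<in> pverts G" "v \<in> pverts G" for u v
  proof
    assume "(f u, f v) \<in> parcs (map_graph f G)"
    from arcE[OF this] obtain u' v' where "f u = f u'" "f v = f v'"
      "u' \<in> pverts G" "v' \<in> pverts G" "(u', v') \<in> parcs G" by blast
    with that show "(u, v) \<in> parcs G" using inj_onD[OF inj] by metis
  next
    assume "(u, v) \<in> parcs G"
    then show "(f u, f v) \<in> parcs (map_graph f G)"
      using map_prod_imageI[of u v "parcs G" f f] by (simp add: map_graph_def)
  qed
  \<comment> \<open>Fixing the preimage of the tail lets a walk be lifted arc by arc with matching
    ends.\<close>
  have arcE': "\<exists>v. b = f v \<and> v \<in> pverts G \<and> (u, v) \<in> parcs G"
    if "(f u, b) \<in> parcs (map_graph f G)" "u \<in> pverts G" for u b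
  proof -
    from arcE[OF that(1)] obtain u' v where "f u = f u'" "b = f v"
      "u' \<in> pverts G" "v \<in> pverts G" "(u', v) \<in> parcs G" by blast
    with inj_onD[OF inj, of u u'] that(2) show ?thesis by blast
  qed
  interpret H: pair_graph "map_graph f G"
  proof (rule pair_graphI)
    show "sym (parcs (map_graph f G))"
      using arcE arc_iff G.arcs_symmetric by (metis symI)
    show "(v, v) \<notin> parcs (map_graph f G)" for v
      using arcE[of v v] inj G.no_loops' by (auto dest: inj_onD)
    show "finite (pverts (map_graph f G))"
      using G.pair_finite_verts by (simp add: map_graph_def)
    show "parcs (map_graph f G) \<subseteq> pverts (map_graph f G) \<times> pverts (map_graph f G)"
      by (auto simp: map_graph_def intro!: imageI intro: verts)
  qed
  have "out_degree (with_proj (map_graph f G)) (f v) = out_degree (with_proj G) v"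
    if v: "v \<in> pverts G" for v
  proof -
    have "{w. (f v, w) \<in> parcs (map_graph f G)} = f ` {w. (v, w) \<in> parcs G}"
    proof (intro equalityI subsetI)
      fix x assume "x \<in> {w. (f v, w) \<in> parcs (map_graph f G)}"
      then obtain u w where "f v = f u" "x = f w" "u \<in> pverts G" "(u, w) \<in> parcs G"
        using arcE[of "f v" x] by blast
      then show "x \<in> f ` {w. (v, w) \<in> parcs G}"
        using inj_onD[OF inj, of v u] v by blast
    next
      fix x assume "x \<in> f ` {w. (v, w) \<in> parcs G}"
      then obtain w where "x = f w" "(v, w) \<in> parcs G" by blast
      then show "x \<in> {w. (f v, w) \<in> parcs (map_graph f G)}"
        using arc_iff[of v w] verts(2)[of v w] v by simp
    qed
    moreover have "inj_on f {w. (v, w) \<in> parcs G}"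
      using verts by (intro inj_on_subset[OF inj]) auto
    ultimately show ?thesis by (simp add: out_degree_with_proj card_image)
  qed
  then have "degree_set (map_graph f G) = degree_set G"
    by (auto simp: degree_set_def map_graph_def image_image intro!: image_cong)
  moreover have "girth_5_relation (parcs (map_graph f G))"
  proof -
    have E: "girth_5_relation (parcs G)"
      using G by (simp add: is_Dg_graph_def G.girth_eq_5_iff)
    then obtain a b c d e where abc: "distinct [a, b, c, d, e]"
        "{(a, b), (b, c), (c, d), (d, e), (e, a)} \<subseteq> parcs G"
      by (rule girth_5_relation.five_cycle)
    show ?thesis
    proof (rule girth_5_relationI)
      have "set [a, b, c, d, e] \<subseteq> pverts G"
        using abc(2) verts by auto
      then have "inj_on f (set [a, b, c, d, e])"
        by (rule inj_on_subset[OF inj])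
      with abc(1) have "distinct (map f [a, b, c, d, e])"
        unfolding distinct_map by (rule conjI)
      then show "distinct [f a, f b, f c, f d, f e]" by simp
      show "{(f a, f b), (f b, f c), (f c, f d), (f d, f e), (f e, f a)} \<subseteq> parcs (map_graph f G)"
        using image_mono[OF abc(2), of "map_prod f f"] by (simp add: map_graph_def)
    next
      \<comment> \<open>One lifted walk of two arcs serves both the triangle and the 4-cycle
        condition.\<close>
      fix x y z assume E': "(x, y) \<in> parcs (map_graph f G)" "(y, z) \<in> parcs (map_graph f G)"
      then obtain a b where ab: "x = f a" "y = f b" "b \<in> pverts G" "(a, b) \<in> parcs G"
        using arcE by blast
      moreover obtain c where c: "z = f c" "c \<in> pverts G" "(b, c) \<in> parcs G"
        using arcE'[of b z] E' ab by blast
      ultimately have a: "a \<in> pverts G" using verts by blast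
      show False if "(z, x) \<in> parcs (map_graph f G)"
        using that girth_5_relation.no_triangle[OF E ab(4) c(3)] arc_iff[of c a] a c ab by simp
      fix w assume zw: "(z, w) \<in> parcs (map_graph f G)" "(w, x) \<in> parcs (map_graph f G)" "x \<noteq> z"
      then obtain d where d: "w = f d" "d \<in> pverts G" "(c, d) \<in> parcs G"
        using arcE'[of c w] c by blast
      moreover have "(d, a) \<in> parcs G"
        using zw(2) arc_iff[of d a] a d ab by simp
      moreover have "a \<noteq> c" using zw(3) ab c by auto
      ultimately show "y = w"
        using girth_5_relation.no_4_cycle[OF E ab(4) c(3) d(3)] ab(2) by simp
    qed
  qed
  ultimately show ?thesis
    using G by (simp add: is_Dg_graph_def H.girth_eq_5_iff H.pair_graph)
qed

lemma min_order_eqI: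
  fixes G :: "'v pair_pre_digraph"
  assumes G: "is_Dg_graph D 5 G"
    and lower: "\<And>H :: nat pair_pre_digraph. is_Dg_graph D 5 H \<Longrightarrow> card (pverts G) \<le> card (pverts H)"
  shows "min_order D 5 = card (pverts G)"
proof -
  interpret pair_graph G
    using G by (simp add: is_Dg_graph_def)
  obtain f :: "'v \<Rightarrow> nat" where f: "inj_on f (pverts G)"
    using finite_imp_inj_to_nat_seg[OF pair_finite_verts] by auto
  have "card (pverts G) = card (pverts (map_graph f G))"
    using f by (simp add: map_graph_def card_image)
  with is_Dg_graph_map_graph[OF G f]
  have "card (pverts G) \<in> {card (pverts H) | H :: nat pair_pre_digraph. is_Dg_graph D 5 H}"
    by (intro CollectI exI conjI)
  then show ?thesis
    unfolding min_order_def using lower by (intro cInf_eq_minimum) auto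
qed

section \<open>The graph \<open>R\<^sub>q\<close>\<close>

lemma symcl_iff: "(u, v) \<in> symcl E \<longleftrightarrow> (u, v) \<in> E \<or> (v, u) \<in> E"
  by (auto simp: symcl_def)

text \<open>Points and lines of the affine plane: \<open>Some m\<close> is the slope of y = mx + b,
  and \<open>None\<close> that of the vertical lines x = b. In the first clause closure puts
  \<open>y\<close> into the carrier.\<close>

fun (in ring) incident :: "'a \<Rightarrow> 'a \<Rightarrow> 'a option \<Rightarrow> 'a \<Rightarrow> bool" where
  "incident x y (Some m) b \<longleftrightarrow> m \<in> carrier R \<and> x \<in> carrier R \<and> b \<in> carrier R \<and> y = m \<otimes> x \<oplus> b"
| "incident x y None b \<longleftrightarrow> x \<in> carrier R \<and> y \<in> carrier R \<and> b = x"

definition (in ring) slopes :: "'a option set" where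
  "slopes = insert None (Some ` carrier R)"

context ring
begin

lemma pverts_R_graph:
  "pverts (R_graph R) =
    case_prod V0 ` (carrier R \<times> carrier R) \<union> case_prod V1 ` (slopes \<times> carrier R)"
  by (auto simp: R_graph_def A_graph_def B_graph_def slopes_def image_iff)

text \<open>Sorting arcs by the kinds of their ends replaces the nested unions and closures. The
  last case is the star centred at intercept 0 within one parallel class.\<close>

lemma R_graph_arc_iff:
  "(V0 x y, V0 x' y') \<in> parcs (R_graph R) \<longleftrightarrow> False"
  "(V0 x y, V1 M b) \<in> parcs (R_graph R) \<longleftrightarrow> incident x y M b"
  "(V1 M b, V0 x y) \<in> parcs (R_graph R) \<longleftrightarrow> incident x y M b"
  "(V1 M b, V1 M' b') \<in> parcs (R_graph R) \<longleftrightarrow>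
     M = M' \<and> M \<in> slopes \<and> b \<in> carrier R \<and> b' \<in> carrier R \<and> b \<noteq> b' \<and> (b = \<zero> \<or> b' = \<zero>)"
  by (cases M; auto simp: R_graph_def A_graph_def B_graph_def slopes_def symcl_iff)+

lemma finite_R_graph: "finite (carrier R) \<Longrightarrow> finite (pverts (R_graph R))"
  by (simp add: pverts_R_graph slopes_def)

lemma card_pverts_R_graph:
  assumes "finite (carrier R)"
  shows "card (pverts (R_graph R)) = card (carrier R) * (2 * card (carrier R) + 1)"
proof -
  have "card slopes = Suc (card (carrier R))"
    using assms by (simp add: slopes_def card_insert_if card_image image_iff)
  moreover have "finite slopes" using assms by (simp add: slopes_def)
  moreover have "card (case_prod V0 ` (carrier R \<times> carrier R)) = card (carrier R) * card (carrier R)"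
    by (subst card_image) (auto simp: inj_on_def card_cartesian_product)
  moreover have "card (case_prod V1 ` (slopes \<times> carrier R)) = card slopes * card (carrier R)"
    by (subst card_image) (auto simp: inj_on_def card_cartesian_product)
  moreover have "case_prod V0 ` (carrier R \<times> carrier R) \<inter> case_prod V1 ` (slopes \<times> carrier R) = {}"
    by auto
  ultimately show ?thesis
    using assms by (simp add: pverts_R_graph card_Un_disjoint algebra_simps)
qed

lemma incident_in_carrier:
  "incident x y M b \<Longrightarrow> x \<in> carrier R \<and> y \<in> carrier R \<and> M \<in> slopes \<and> b \<in> carrier R"
  by (cases M) (auto simp: slopes_def)

lemma pair_graph_R_graph:
  assumes "finite (carrier R)"
  shows "pair_graph (R_graph R)"
proof (rule pair_graphI)
  show "parcs (R_graph R) \<subseteq> pverts (R_graph R) \<times> pverts (R_graph R)"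
  proof (rule subrelI)
    fix u v assume "(u, v) \<in> parcs (R_graph R)"
    then show "(u, v) \<in> pverts (R_graph R) \<times> pverts (R_graph R)"
      by (cases u; cases v) (auto simp: R_graph_arc_iff pverts_R_graph image_iff dest: incident_in_carrier)
  qed
  show "sym (parcs (R_graph R))"
  proof (rule symI)
    fix u v assume "(u, v) \<in> parcs (R_graph R)"
    then show "(v, u) \<in> parcs (R_graph R)"
      by (cases u; cases v) (auto simp: R_graph_arc_iff)
  qed
  show "(v, v) \<notin> parcs (R_graph R)" for v
    by (cases v) (auto simp: R_graph_arc_iff)
qed (rule finite_R_graph[OF assms])

section \<open>Parallel classes and degrees\<close>

lemma incident_unique:
  assumes "incident x y M b" "incident x y M b'"
  shows "b = b'"
proof (cases M)
  case (Some m)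
  with assms have "m \<otimes> x \<oplus> b = m \<otimes> x \<oplus> b'" by simp
  then show ?thesis
    by (rule add.l_cancel) (use assms Some in auto)
qed (use assms in auto)

lemma ex_incident:
  assumes "x \<in> carrier R" "y \<in> carrier R" "M \<in> slopes"
  shows "\<exists>b. incident x y M b"
proof (cases M)
  case (Some m)
  \<comment> \<open>The intercept is y = mx + b solved for b.\<close>
  then have "incident x y M (\<ominus> (m \<otimes> x) \<oplus> y)"
    using assms by (auto simp: slopes_def r_neg2)
  then show ?thesis ..
qed (use assms in auto)

text \<open>Each slope contributes exactly one line through the point, so the q + 1 slopes
  parametrise the neighbours.\<close>

lemma card_lines_through_point:
  assumes "finite (carrier R)" "x \<in> carrier R" "y \<in> carrier R"
  shows "card {v. (V0 x y, v) \<in> parcs (R_graph R)} = card (carrier R) + 1"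
proof -
  define b where "b M = (SOME b. incident x y M b)" for M
  have b: "incident x y M (b M)" if "M \<in> slopes" for M
    unfolding b_def using ex_incident[OF assms(2,3) that] by (rule someI_ex)
  have "{v. (V0 x y, v) \<in> parcs (R_graph R)} = (\<lambda>M. V1 M (b M)) ` slopes"
  proof (intro equalityI subsetI)
    fix v assume "v \<in> {v. (V0 x y, v) \<in> parcs (R_graph R)}"
    then obtain M c where "v = V1 M c" "incident x y M c"
      by (cases v) (auto simp: R_graph_arc_iff)
    then show "v \<in> (\<lambda>M. V1 M (b M)) ` slopes"
      using incident_unique[of x y M c "b M"] b incident_in_carrier by blast
  qed (use b in \<open>auto simp: R_graph_arc_iff\<close>)
  moreover have "card ((\<lambda>M. V1 M (b M)) ` slopes) = card slopes"
    by (rule card_image) (simp add: inj_on_def)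
  ultimately show ?thesis
    using assms by (simp add: slopes_def card_insert_if card_image image_iff)
qed

text \<open>A line is parametrised by its free coordinate: y if it is vertical, x otherwise.\<close>

lemma card_points_on_line:
  assumes "M \<in> slopes" "b \<in> carrier R"
  shows "card {v. \<exists>x y. v = V0 x y \<and> incident x y M b} = card (carrier R)"
proof (cases M)
  case None
  then have "{v. \<exists>x y. v = V0 x y \<and> incident x y M b} = V0 b ` carrier R"
    using assms by auto
  then show ?thesis by (simp add: card_image inj_on_def)
next
  case (Some m)
  then have "{v. \<exists>x y. v = V0 x y \<and> incident x y M b} = (\<lambda>x. V0 x (m \<otimes> x \<oplus> b)) ` carrier R"
    using assms by (auto simp: slopes_def)
  then show ?thesis by (simp add: card_image inj_on_def)
qed

text \<open>To the q points on the line come its neighbours in the star: q - 1 leaves if it is the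
  centre, otherwise the centre alone.\<close>

lemma card_neighbours_line:
  assumes fin: "finite (carrier R)" and M: "M \<in> slopes" and b: "b \<in> carrier R"
  shows "card {v. (V1 M b, v) \<in> parcs (R_graph R)} =
    (if b = \<zero> then 2 * card (carrier R) - 1 else card (carrier R) + 1)"
proof -
  define P where "P = {v. \<exists>x y. v = V0 x y \<and> incident x y M b}"
  define S where "S = V1 M ` (if b = \<zero> then carrier R - {\<zero>} else {\<zero>})"
  have "{v. (V1 M b, v) \<in> parcs (R_graph R)} = P \<union> S"
  proof (rule Set.set_eqI)
    fix v show "v \<in> {v. (V1 M b, v) \<in> parcs (R_graph R)} \<longleftrightarrow> v \<in> P \<union> S"
      using M b by (cases v) (auto simp: P_def S_def R_graph_arc_iff)
  qed
  moreover have "P \<inter> S = {}" by (auto simp: P_def S_def)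
  moreover have "finite P"
  proof (rule finite_subset)
    show "P \<subseteq> case_prod V0 ` (carrier R \<times> carrier R)"
      by (auto simp: P_def dest: incident_in_carrier)
  qed (use fin in simp)
  moreover have "finite S" using fin by (simp add: S_def)
  moreover have "card S = (if b = \<zero> then card (carrier R) - 1 else 1)"
    by (simp add: S_def card_image inj_on_def card_Diff_singleton)
  moreover have "card P = card (carrier R)"
    using card_points_on_line[OF M b] by (simp add: P_def)
  moreover have "card (carrier R) > 0" using fin b by (auto simp: card_gt_0_iff)
  ultimately show ?thesis by (simp add: card_Un_disjoint mult_2)
qed

lemma degree_set_R_graph:
  assumes "finite (carrier R)"
  shows "degree_set (R_graph R) = {card (carrier R) + 1, 2 * card (carrier R) - 1}"
proof -
  have "degree_set (R_graph R) = (\<lambda>_. card (carrier R) + 1) ` (carrier R \<times> carrier R) \<union>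
      (\<lambda>(M, b). if b = \<zero> then 2 * card (carrier R) - 1 else card (carrier R) + 1) ` (slopes \<times> carrier R)"
    unfolding degree_set_def out_degree_with_proj pverts_R_graph image_Un image_image
    using assms by (intro arg_cong2[where f="(\<union>)"] image_cong)
      (auto simp: card_lines_through_point card_neighbours_line)
  also have "\<dots> = {card (carrier R) + 1, 2 * card (carrier R) - 1}"
    (is "?A \<union> ?B = _")
  proof -
    have "?A = {card (carrier R) + 1}" using zero_closed by auto
    moreover have "?B \<subseteq> {card (carrier R) + 1, 2 * card (carrier R) - 1}" by auto
    \<comment> \<open>A star centre has the larger degree; the points already supply the other. For
      order 2 both values are 3.\<close>
    moreover have "2 * card (carrier R) - 1 \<in> ?B"
      by (rule image_eqI[where x = "(None, \<zero>)"]) (simp_all add: slopes_def)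
    ultimately show ?thesis by blast
  qed
  finally show ?thesis .
qed

end

section \<open>Girth of \<open>R_graph\<close> over a field\<close>

context field
begin

text \<open>For two non-vertical lines the equations subtract to (m - m')(x - x') = 0, and a field
  has no zero divisors. If just one line is vertical, x = x' and the other line forces y =
  y'.\<close>

lemma incident_joining_line_unique:
  assumes "incident x y M b" "incident x' y' M b" "incident x y M' b'" "incident x' y' M' b'"
    and ne: "(x, y) \<noteq> (x', y')"
  shows "M = M' \<and> b = b'"
proof -
  have "M = M'"
  proof (cases M; cases M')
    fix m m' assume M: "M = Some m" "M' = Some m'"
    have c: "x \<in> carrier R" "x' \<in> carrier R" "m \<in> carrier R" "m' \<in> carrier R" "b \<in> carrier R" "b' \<in> carrier R"
      using assms M by auto
    have "(m \<ominus> m') \<otimes> (x \<ominus> x') = (m \<otimes> x \<oplus> b) \<ominus> (m \<otimes> x' \<oplus> b) \<ominus> ((m' \<otimes> x \<oplus> b') \<ominus> (m' \<otimes> x' \<oplus> b'))"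
      using c by algebra
    also have "\<dots> = (y \<ominus> y') \<ominus> (y \<ominus> y')" using assms M by simp
    also have "\<dots> = \<zero>" using assms M c by (simp add: r_right_minus_eq)
    finally have "m \<ominus> m' = \<zero> \<or> x \<ominus> x' = \<zero>" using c integral[of "m \<ominus> m'" "x \<ominus> x'"] by blast
    moreover have "x \<noteq> x'" using assms M by auto
    ultimately show "M = M'" using c M by simp
  qed (use assms in auto)
  with assms incident_unique show ?thesis by blast
qed

text \<open>A short cycle containing a point is rotated to start there; one without points would lie
  in a single star, which has no cycles.\<close>

lemma girth_5_relation_R_graph: "girth_5_relation (parcs (R_graph R))"
proof (rule girth_5_relationI)
  let ?E = "parcs (R_graph R)"
  have V0E: "\<exists>M b. v = V1 M b \<and> incident x y M b" if "(V0 x y, v) \<in> ?E" for x y v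
    using that by (cases v) (simp_all add: R_graph_arc_iff)
  have sym: "(v, u) \<in> ?E" if "(u, v) \<in> ?E" for u v
    using that by (cases u; cases v) (auto simp: R_graph_arc_iff)
  have V0_triangle: False if uvw: "(u, v) \<in> ?E" "(v, w) \<in> ?E" "(w, u) \<in> ?E" and u: "u = V0 x y" for u v w x y
  proof -
    obtain M b where v: "v = V1 M b" "incident x y M b"
      using V0E uvw(1) u by blast
    obtain M' b' where w: "w = V1 M' b'" "incident x y M' b'"
      using V0E[of x y w] sym[OF uvw(3)] u by blast
    \<comment> \<open>Adjacent lines are parallel and distinct, so they cannot share the point (x,
      y).\<close>
    show False
      using uvw(2) v w incident_unique[of x y M b b'] by (auto simp: R_graph_arc_iff)
  qed
  show False if "(u, v) \<in> ?E" "(v, w) \<in> ?E" "(w, u) \<in> ?E" for u v w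
  proof -
    have "u \<noteq> V0 x y" "v \<noteq> V0 x y" "w \<noteq> V0 x y" for x y
      using V0_triangle[OF that] V0_triangle[OF that(2,3,1)] V0_triangle[OF that(3,1,2)] by blast+
    then obtain M b N c K d where "u = V1 M b" "v = V1 N c" "w = V1 K d"
      by (metis vertex.exhaust)
    then show False using that by (auto simp: R_graph_arc_iff)
  qed
  have V0_4_cycle: "v = z" if E: "(u, v) \<in> ?E" "(v, w) \<in> ?E" "(w, z) \<in> ?E" "(z, u) \<in> ?E" "u \<noteq> w"
    and u: "u = V0 x y" for u v w z x y
  proof -
    obtain M b where v: "v = V1 M b" "incident x y M b"
      using V0E E(1) u by blast
    obtain M' b' where z: "z = V1 M' b'" "incident x y M' b'"
      using V0E[of x y z] sym[OF E(4)] u by blast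
    show ?thesis
    \<comment> \<open>If \<open>w\<close> is a point, \<open>v\<close> and \<open>z\<close> both
      join it to (x, y). If \<open>w\<close> is a line, they are both parallel to it and meet in (x,
      y). Either way they coincide.\<close>
    proof (cases w)
      case (V0 x' y')
      then have "incident x' y' M b" "incident x' y' M' b'" "(x, y) \<noteq> (x', y')"
        using E v z u by (auto simp: R_graph_arc_iff)
      then show ?thesis
        using incident_joining_line_unique[OF v(2) _ z(2)] v z by blast
    next
      case (V1 N c)
      then have "M' = M" using E v z by (simp add: R_graph_arc_iff)
      then show ?thesis using v z incident_unique by blast
    qed
  qed
  show "v = z" if E: "(u, v) \<in> ?E" "(v, w) \<in> ?E" "(w, z) \<in> ?E" "(z, u) \<in> ?E" "u \<noteq> w" for u v w z
  proof (rule ccontr)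
    assume ne: "v \<noteq> z"
    have "u \<noteq> V0 x y" "v \<noteq> V0 x y" "w \<noteq> V0 x y" "z \<noteq> V0 x y" for x y
      using V0_4_cycle[OF E] V0_4_cycle[OF E(2,3,4,1) ne] V0_4_cycle[OF E(3,4,1,2) E(5)[symmetric]]
        V0_4_cycle[OF E(4,1,2,3) ne[symmetric]] E(5) ne by blast+
    then obtain M b M' b' N c N' c' where "u = V1 M b" "w = V1 M' b'" "v = V1 N c" "z = V1 N' c'"
      by (metis vertex.exhaust)
    then show False using E ne by (auto simp: R_graph_arc_iff)
  qed
  \<comment> \<open>The lines y = 0 and y = 1 are joined by a new edge, and the line x = 0 meets
    them in (0, 0) and (0, 1).\<close>
  show "distinct [V0 \<zero> \<zero>, V1 (Some \<zero>) \<zero>, V1 (Some \<zero>) \<one>, V0 \<zero> \<one>, V1 None \<zero>]"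
    by simp
  show "{(V0 \<zero> \<zero>, V1 (Some \<zero>) \<zero>), (V1 (Some \<zero>) \<zero>, V1 (Some \<zero>) \<one>), (V1 (Some \<zero>) \<one>, V0 \<zero> \<one>),
      (V0 \<zero> \<one>, V1 None \<zero>), (V1 None \<zero>, V0 \<zero> \<zero>)} \<subseteq> ?E"
    by (simp add: R_graph_arc_iff slopes_def)
qed

lemma is_Dg_graph_R_graph:
  assumes fin: "finite (carrier R)"
  shows "is_Dg_graph {card (carrier R) + 1, 2 * card (carrier R) - 1} 5 (R_graph R)"
  using pair_graph_R_graph[OF fin] degree_set_R_graph[OF fin] girth_5_relation_R_graph
    pair_graph.girth_eq_5_iff[OF pair_graph_R_graph[OF fin]]
  by (simp add: is_Dg_graph_def)

end

section \<open>Order of \<open>R_graph\<close> against the lower bound\<close>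

lemma R_graph_cage:
  fixes F :: "('a, 'b) ring_scheme"
  assumes F: "field F" and q: "card (carrier F) = q" "2 \<le> q" "r = q + 1"
  shows "is_Dg_cage {r, 2 * r - 3} 5 (R_graph F)"
    and "min_order {r, 2 * r - 3} 5 = r * (2 * r - 3) + 1"
proof -
  interpret F: field F by fact
  have fin: "finite (carrier F)" using q by (metis card.infinite not_numeral_le_zero)
  \<comment> \<open>\<open>q \<ge> 2\<close> makes \<open>r\<close> the smaller degree, so Downs'
    bound applies at a vertex of degree \<open>2 * r - 3\<close>.\<close>
  have r: "2 * r - 3 = 2 * q - 1" "r \<le> 2 * r - 3" using q by auto
  have D: "is_Dg_graph {r, 2 * r - 3} 5 (R_graph F)"
    using F.is_Dg_graph_R_graph[OF fin] q r by simp
  have "card (pverts (R_graph F)) = q * (2 * q + 1)"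
    using F.card_pverts_R_graph[OF fin] q by simp
  also have "\<dots> = r * (2 * r - 3) + 1"
  proof -
    \<comment> \<open>Writing q as a successor removes the truncated subtraction from q(2q + 1) = (q
      + 1)(2q - 1) + 1.\<close>
    obtain k where "q = Suc k" using q by (cases q) auto
    then show ?thesis using q(3) by simp
  qed
  finally have card: "card (pverts (R_graph F)) = r * (2 * r - 3) + 1" .
  have "r * (2 * r - 3) + 1 \<le> card (pverts H)" if H: "is_Dg_graph {r, 2 * r - 3} 5 H"
    for H :: "nat pair_pre_digraph"
  proof -
    interpret H: pair_graph H using H by (simp add: is_Dg_graph_def)
    have deg: "out_degree (with_proj H) ` pverts H = {r, 2 * r - 3}"
      using H by (simp add: is_Dg_graph_def degree_set_def)
    then obtain v where v: "v \<in> pverts H" "out_degree (with_proj H) v = 2 * r - 3"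
      by (metis imageE insertCI)
    have "r \<le> out_degree (with_proj H) w" if "w \<in> pverts H" for w
      using imageI[OF that, of "out_degree (with_proj H)"] deg r by auto
    with H.Downs_lower_bound[OF _ v(1), of r] show ?thesis
      using H v(2) by (simp add: is_Dg_graph_def H.girth_eq_5_iff mult.commute)
  qed
  with min_order_eqI[OF D] card
  show "min_order {r, 2 * r - 3} 5 = r * (2 * r - 3) + 1" by simp
  with D card show "is_Dg_cage {r, 2 * r - 3} 5 (R_graph F)"
    by (simp add: is_Dg_cage_def)
qed

theorem theorem3p1:
  fixes q r :: nat
  assumes "2 \<le> q" and "primepow q" and "r = q + 1"
  shows "(\<forall>F :: ('a, 'b) ring_scheme. field F \<and> card (carrier F) = q \<longrightarrow>
            is_Dg_cage {r, 2 * r - 3} 5 (R_graph F)) \<and>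
         min_order {r, 2 * r - 3} 5 = r * (2 * r - 3) + 1"
proof (intro conjI allI impI)
  fix F :: "('a, 'b) ring_scheme"
  assume "field F \<and> card (carrier F) = q"
  then show "is_Dg_cage {r, 2 * r - 3} 5 (R_graph F)"
    using R_graph_cage(1)[of F q r] assms by blast
next
  obtain F :: "((int list \<times> nat) multiset \<Rightarrow> int) ring" where "field F" "card (carrier F) = q"
    using finite_field_exists[OF assms(2)] by blast
  then show "min_order {r, 2 * r - 3} 5 = r * (2 * r - 3) + 1"
    using assms(1,3) by (rule R_graph_cage(2))
qed

end
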